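(* Let $v:\mathbb{R}\to\mathbb{R}$ be a $1$-periodic, real-analytic, non-constant function. For every $q\in\mathbb{N}$ there exist $\lambda_0=\lambda_0(v,q)>0$ and a constant $C=C(v,q)<\infty$ such that the following holds: for every $\lambda>\lambda_0$, every frequency $\omega\in\mathbb{T}$, every background sequence $v_1:\mathbb{Z}\to\mathbb{R}$ taking at most $q$ distinct values, and every energy $E\in\mathbb{R}$, $$L(E)\;\ge\;\ln\lambda - C .$$ In particular, $\lambda_0$ and $C$ do not depend on $E$, $\omega$, or the background $v_1$.
   Context: We identify $\mathbb{T}=\mathbb{R}/\mathbb{Z}$ and view $v$ as a function on $\mathbb{T}$. The operator under consideration is $H=H^v_{\lambda,\omega,x}+v_1$ on $\ell^2(\mathbb{Z})$, $(Hu)(n)=u(n-1)+u(n+1)+\big(\lambda v(x+n\omega)+v_1(n)\big)u(n)$, with $x,\omega\in\mathbb{T}$, $\lambda>0$. For $N\ge 1$, $x\in\mathbb{T}$, $E\in\mathbb{R}$, define the transfer matrix $$M_N(x,E,\omega)=\prod_{k=N}^{1}\begin{pmatrix}E-\lambda v(x+k\omega)-v_1(k) & -1\\ 1 & 0\end{pmatrix}$$ (the product ordered with the factor $k=N$ on the left and $k=1$ on the right), and $$L_N(E)=\frac1N\int_{\mathbb{T}}\ln\|M_N(x,E,\omega)\|\,dx,\qquad L(E)=\liminf_{N\to\infty}L_N(E)$$ (the lower Lyapunov exponent), where $\|\cdot\|$ is the operator norm. *)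

theory Defs
  imports "HOL-Analysis.Analysis"
begin

definition real_analytic :: "(real \<Rightarrow> real) \<Rightarrow> bool" where
  "real_analytic f \<longleftrightarrow> (\<forall>x0. \<exists>r>0. \<exists>a::nat \<Rightarrow> real.
      \<forall>y. \<bar>y - x0\<bar> < r \<longrightarrow> (\<lambda>n. a n * (y - x0) ^ n) sums f y)"

definition step_matrix ::
  "(real \<Rightarrow> real) \<Rightarrow> (int \<Rightarrow> real) \<Rightarrow> real \<Rightarrow> real \<Rightarrow> real \<Rightarrow> real \<Rightarrow> nat \<Rightarrow> real^2^2" where
  "step_matrix v v1 lam om x E k =
     vector [vector [E - lam * v (x + real k * om) - v1 (int k), -1],
             vector [1, 0]]"

fun transfer_matrix ::
  "(real \<Rightarrow> real) \<Rightarrow> (int \<Rightarrow> real) \<Rightarrow> real \<Rightarrow> real \<Rightarrow> nat \<Rightarrow> real \<Rightarrow> real \<Rightarrow> real^2^2" where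
  "transfer_matrix v v1 lam om 0 x E = mat 1"
| "transfer_matrix v v1 lam om (Suc n) x E =
     step_matrix v v1 lam om x E (Suc n) ** transfer_matrix v v1 lam om n x E"

definition op_norm :: "real^2^2 \<Rightarrow> real" where
  "op_norm A = onorm (\<lambda>u. A *v u)"

definition L_N :: "(real \<Rightarrow> real) \<Rightarrow> (int \<Rightarrow> real) \<Rightarrow> real \<Rightarrow> real \<Rightarrow> nat \<Rightarrow> real \<Rightarrow> real" where
  "L_N v v1 lam om N E =
     (1 / real N) * integral {0..1} (\<lambda>x. ln (op_norm (transfer_matrix v v1 lam om N x E)))"

definition lower_lyap :: "(real \<Rightarrow> real) \<Rightarrow> (int \<Rightarrow> real) \<Rightarrow> real \<Rightarrow> real \<Rightarrow> real \<Rightarrow> ereal" where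
  "lower_lyap v v1 lam om E = liminf (\<lambda>N. ereal (L_N v v1 lam om N E))"

end

(* Extend v to a holomorphic 1-periodic function V on a strip |Im z| < rho. For real z the (1,1) entry
   of the transfer matrix M_N is a continuant in the numbers E - lam v(z + k om) - v1(k), so it extends to a
   holomorphic 1-periodic function f. With w_k = (E - v1(k)) / lam and s_k = max 1 |w_k|, compactness and the
   discreteness of zeros give c > 0, depending on v and q only, and a height y, depending on the at most q
   values w_k, with |V - w_k| >= c s_k on the whole line Im z = y. There |f| is at least the product of the
   lam s_k c / 2, while on a fixed higher line Im z = h it is at most the product of the lam s_k (S + 2).
   Convexity in the height of the mean of ln |f| turns these bounds into a lower bound for the mean over the
   real axis, in which the s_k >= 1 can only help, because both bounds contain them in the same way. *)
theory Submission
  imports Defs "HOL-Complex_Analysis.Complex_Analysis" "HOL-Library.Periodic_Fun"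
begin

unbundle no fps_syntax

section \<open>Holomorphic extension to a strip\<close>

definition strip :: "real \<Rightarrow> complex set" where
  "strip \<rho> = {z. \<bar>Im z\<bar> < \<rho>}"

lemma open_strip: "open (strip \<rho>)"
  unfolding strip_def by (intro open_Collect_less continuous_intros)

lemma convex_strip: "convex (strip \<rho>)"
proof -
  have "strip \<rho> = {z. Im z < \<rho>} \<inter> {z. Im z > - \<rho>}"
    by (auto simp: strip_def)
  then show ?thesis
    using convex_halfspace_Im_lt convex_halfspace_Im_gt by (auto intro: convex_Int)
qed

lemma connected_strip: "connected (strip \<rho>)"
  by (simp add: convex_connected convex_strip)

text \<open>An open set containing a real point contains a real interval around it, so its real
  points accumulate and the identity theorem applies. This serves both to glue local extensions of
  \<open>v\<close> and to carry its periodicity over to complex arguments.\<close>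

lemma holomorphic_eq_from_reals:
  assumes f: "f holomorphic_on S" and g: "g holomorphic_on S"
    and S: "open S" "connected S" and x: "of_real x \<in> S"
    and eq: "\<And>y. of_real y \<in> S \<Longrightarrow> f (of_real y) = g (of_real y)"
    and z: "z \<in> S"
  shows "f z = g z"
proof -
  have "(of_real x :: complex) islimpt S \<inter> \<real>"
  proof (rule islimptI)
    fix T assume T: "of_real x \<in> T" "open (T :: complex set)"
    then obtain e where e: "e > 0" "ball (of_real x) e \<subseteq> T \<inter> S"
      using S x open_contains_ball[of "T \<inter> S"] by (metis IntI open_Int)
    let ?y = "of_real (x + e/2) :: complex"
    have "dist (of_real x) ?y < e"
      using e by (simp add: dist_norm norm_minus_commute)
    then have "?y \<in> T \<inter> S"
      using e by (metis mem_ball subsetD)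
    then show "\<exists>y\<in>S \<inter> \<real>. y \<in> T \<and> y \<noteq> of_real x"
      using e by (intro bexI[of _ ?y]) auto
  qed
  then have "f z - g z = 0"
    using f g S x z eq
    by (intro analytic_continuation[of "\<lambda>z. f z - g z" S "S \<inter> \<real>" "of_real x" z])
       (auto intro!: holomorphic_intros simp: Reals_def)
  then show ?thesis by simp
qed

lemma real_analytic_local_extension:
  assumes "real_analytic v"
  shows "\<exists>r>0. \<exists>F. F holomorphic_on ball (of_real x) r \<and>
           (\<forall>y. of_real y \<in> ball (complex_of_real x) r \<longrightarrow> F (of_real y) = complex_of_real (v y))"
proof -
  obtain r a where r: "r > 0"
    and a: "\<And>y. \<bar>y - x\<bar> < r \<Longrightarrow> (\<lambda>n. a n * (y - x) ^ n) sums v y"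
    using assms unfolding real_analytic_def by meson
  define F where "F z = (\<Sum>n. of_real (a n) * (z - of_real x) ^ n)" for z :: complex
  have sums: "(\<lambda>n. of_real (a n) * (z - of_real x) ^ n) sums F z"
    if z: "z \<in> ball (of_real x) r" for z
  proof -
    have "norm (z - of_real x) < r"
      using z by (simp add: dist_norm norm_minus_commute)
    \<comment> \<open>The real series converges at \<open>x + s\<close>, which is farther from the
      centre than \<open>z\<close>, so the complex series converges at \<open>z\<close>. The complex
      radius is therefore no smaller than the real one.\<close>
    then obtain s where s: "norm (z - of_real x) < s" "s < r"
      using dense by blast
    then have "s > 0"
      using norm_ge_zero le_less_trans by blast
    with s have "(\<lambda>n. a n * s ^ n) sums v (x + s)"
      using a[of "x + s"] by simp
    then have "(\<lambda>n. complex_of_real (a n * s ^ n)) sums of_real (v (x + s))"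
      by (subst sums_of_real_iff)
    then have "summable (\<lambda>n. complex_of_real (a n) * of_real s ^ n)"
      by (simp add: sums_iff)
    then have "summable (\<lambda>n. complex_of_real (a n) * (z - of_real x) ^ n)"
      using s \<open>s > 0\<close> by (elim powser_inside) simp
    then show ?thesis
      by (simp add: F_def summable_sums)
  qed
  have "F holomorphic_on ball (of_real x) r"
    using sums by (rule power_series_holomorphic)
  moreover have "F (of_real y) = of_real (v y)" if y: "of_real y \<in> ball (complex_of_real x) r" for y
  proof -
    have "\<bar>y - x\<bar> < r"
      using y by (simp add: dist_norm norm_minus_commute flip: of_real_diff)
    then have "(\<lambda>n. complex_of_real (a n * (y - x) ^ n)) sums of_real (v y)"
      using a by (subst sums_of_real_iff)
    then have "(\<lambda>n. of_real (a n) * (of_real y - of_real x) ^ n) sums complex_of_real (v y)"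
      by simp
    with sums[OF y] show ?thesis
      using sums_unique2 by blast
  qed
  ultimately show ?thesis using r by blast
qed

text \<open>A radius independent of \<open>x\<close> is what makes the discs fill a strip. It is a
  Lebesgue number of a cover of one period; every other centre is reduced to its fractional part by
  an integer translation.\<close>

lemma real_analytic_uniform_extension:
  assumes per: "\<And>x. v (x + 1) = v x" and an: "real_analytic v"
  shows "\<exists>r>0. \<forall>x. \<exists>F. F holomorphic_on ball (of_real x) r \<and>
           (\<forall>y. of_real y \<in> ball (complex_of_real x) r \<longrightarrow> F (of_real y) = complex_of_real (v y))"
proof -
  interpret v: periodic_fun_simple v 1
    by standard (rule per)
  let ?P = "\<lambda>G F. F holomorphic_on G \<and>
           (\<forall>y. of_real y \<in> G \<longrightarrow> F (of_real y) = complex_of_real (v y))"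
  define \<G> where "\<G> = {G. open G \<and> (\<exists>F. ?P G F)}"
  have "compact (complex_of_real ` {0..1})"
    by (intro compact_continuous_image continuous_intros) auto
  moreover have "complex_of_real ` {0..1} \<subseteq> \<Union>\<G>"
  proof
    fix z assume "z \<in> complex_of_real ` {0..1}"
    then obtain x where z: "z = of_real x" by blast
    obtain r where "r > 0" "\<exists>F. ?P (ball z r) F"
      using real_analytic_local_extension[OF an, of x] z by blast
    then have "ball z r \<in> \<G>" "z \<in> ball z r"
      by (auto simp: \<G>_def)
    then show "z \<in> \<Union>\<G>" by blast
  qed
  moreover have "open G" if "G \<in> \<G>" for G
    using that by (simp add: \<G>_def)
  ultimately obtain r where r: "r > 0"
    and G: "\<And>z. z \<in> complex_of_real ` {0..1} \<Longrightarrow> \<exists>G\<in>\<G>. ball z r \<subseteq> G"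
    using Heine_Borel_lemma by meson
  have "\<exists>F. ?P (ball (of_real x) r) F" for x
  proof -
    have "complex_of_real (frac x) \<in> complex_of_real ` {0..1}"
      by (intro imageI) (simp add: frac_ge_0 less_imp_le[OF frac_lt_1])
    then obtain G F where F: "?P G F" and sub: "ball (of_real (frac x)) r \<subseteq> G"
      using G unfolding \<G>_def by blast
    define n where "n = \<lfloor>x\<rfloor>"
    have x: "of_real x - of_int n = complex_of_real (frac x)"
      by (simp add: frac_def n_def)
    have shift: "z - of_int n \<in> ball (of_real (frac x)) r" if "z \<in> ball (of_real x) r" for z :: complex
      using that by (simp add: dist_norm algebra_simps flip: x)
    have "(F \<circ> (\<lambda>z. z - of_int n)) holomorphic_on ball (of_real x) r"
      using F sub shift by (intro holomorphic_on_compose_gen[where t=G]) (auto intro!: holomorphic_intros)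
    moreover have "F (of_real y - of_int n) = of_real (v y)" if "of_real y \<in> ball (complex_of_real x) r" for y
    proof -
      have "of_real (y - of_int n) \<in> G"
        using sub shift[OF that] by auto
      then have "F (of_real (y - of_int n)) = of_real (v (y - of_int n))"
        using F by blast
      then show ?thesis
        using v.minus_of_int[of y n] by simp
    qed
    ultimately show ?thesis
      by (auto simp: o_def)
  qed
  with r show ?thesis by blast
qed

text \<open>The local extensions glue because any two discs centred on the real line that meet
  also meet on the real line.\<close>

lemma periodic_real_analytic_extension:
  assumes per: "\<And>x. v (x + 1) = v x" and an: "real_analytic v"
  obtains \<rho> V where "\<rho> > 0" "V holomorphic_on strip \<rho>"
    "\<And>z. V (z + 1) = V z" "\<And>x. V (of_real x) = complex_of_real (v x)"
proof -
  obtain r F where r: "r > 0"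
    and F: "\<And>x. F x holomorphic_on ball (of_real x) r"
    and Fv: "\<And>x y. of_real y \<in> ball (complex_of_real x) r \<Longrightarrow> F x (of_real y) = complex_of_real (v y)"
    using real_analytic_uniform_extension[OF assms] by metis
  \<comment> \<open>The disc centred at \<open>Re z\<close> selects the local extension. The value 0
    outside the strip makes the periodicity of \<open>V\<close> hold for all complex
    \<open>z\<close>.\<close>
  define V where "V z = (if z \<in> strip r then F (Re z) z else 0)" for z
  have VF: "V z = F x z" if z: "z \<in> ball (of_real x) r" for x z
  proof -
    let ?B = "ball (complex_of_real x) r \<inter> ball (of_real (Re z)) r"
    have "cmod (z - of_real x) < r"
      using z by (simp add: dist_norm norm_minus_commute)
    then have le: "\<bar>Re z - x\<bar> < r" "\<bar>Im z\<bar> < r"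
      using abs_Re_le_cmod[of "z - of_real x"] abs_Im_le_cmod[of "z - of_real x"] by auto
    have "z - of_real (Re z) = \<i> * of_real (Im z)"
      by (simp add: complex_eq_iff)
    then have "cmod (z - of_real (Re z)) = \<bar>Im z\<bar>"
      by (simp add: norm_mult)
    then have "z \<in> ?B"
      using z le by (simp add: dist_norm norm_minus_commute[of "of_real (Re z)"])
    moreover have "of_real (Re z) \<in> ?B"
      using le r by (simp add: dist_of_real dist_real_def)
    moreover have "connected ?B"
      by (intro convex_connected convex_Int convex_ball)
    moreover have "F (Re z) holomorphic_on ?B" "F x holomorphic_on ?B"
      by (auto intro: holomorphic_on_subset[OF F])
    moreover have "F (Re z) (of_real y) = F x (of_real y)" if "of_real y \<in> ?B" for y
      using Fv[of y x] Fv[of y "Re z"] that by simp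
    ultimately have "F (Re z) z = F x z"
      using holomorphic_eq_from_reals[of "F (Re z)" ?B "F x" "Re z" z] by auto
    then show ?thesis
      using le by (simp add: V_def strip_def)
  qed
  have hol: "V holomorphic_on strip r"
  proof (rule holomorphic_on_subset[OF holomorphic_on_UN_open])
    show "strip r \<subseteq> (\<Union>x. ball (complex_of_real x) r)"
    proof
      fix z assume "z \<in> strip r"
      moreover have "of_real (Re z) - z = - \<i> * of_real (Im z)"
        by (simp add: complex_eq_iff)
      then have "dist (of_real (Re z)) z = \<bar>Im z\<bar>"
        by (simp add: dist_norm norm_mult)
      ultimately have "z \<in> ball (of_real (Re z)) r"
        by (simp add: strip_def)
      then show "z \<in> (\<Union>x. ball (complex_of_real x) r)" by blast
    qed
    show "V holomorphic_on ball (of_real x) r" for x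
      using F[of x] by (rule holomorphic_transform) (simp add: VF)
  qed auto
  have real: "V (of_real x) = complex_of_real (v x)" for x
    using VF[of "of_real x" x] Fv[of x x] r by simp
  have "V (z + 1) = V z" for z
  proof (cases "z \<in> strip r")
    case True
    have "(V \<circ> (\<lambda>z. z + 1)) holomorphic_on strip r"
      using hol by (rule holomorphic_on_compose_gen[rotated]) (auto intro!: holomorphic_intros simp: strip_def)
    then have "(\<lambda>z. V (z + 1)) holomorphic_on strip r"
      by (simp add: o_def)
    moreover have "V (of_real y + 1) = V (of_real y)" for y
      using real[of "y + 1"] real[of y] per[of y] by simp
    moreover have "of_real 0 \<in> strip r"
      using r by (simp add: strip_def)
    ultimately show ?thesis
      using holomorphic_eq_from_reals[OF _ hol open_strip connected_strip _ _ True] by blast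
  qed (simp add: V_def strip_def)
  with r hol real show ?thesis using that by blast
qed

section \<open>Lines on which finitely many values are avoided\<close>

text \<open>Reduction to one period at unchanged height: compactness of a rectangle then gives
  bounds on whole horizontal lines.\<close>

lemma periodic_frac:
  assumes "\<And>z. V (z + 1) = V z"
  shows "V z = V (Complex (frac (Re z)) (Im z))"
proof -
  interpret V: periodic_fun_simple V "1 :: complex"
    by standard (rule assms)
  have "Complex (frac (Re z)) (Im z) = z - of_int \<lfloor>Re z\<rfloor> * 1"
    by (simp add: complex_eq_iff frac_def)
  then show ?thesis
    using V.minus_of_int[of z "\<lfloor>Re z\<rfloor>"] by metis
qed

lemma holomorphic_on_strip_translate:
  assumes "f holomorphic_on strip \<rho>"
  shows "(\<lambda>z. f (z + of_real t)) holomorphic_on strip \<rho>"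
  using holomorphic_on_compose_gen[OF _ assms, of "\<lambda>z. z + of_real t" "strip \<rho>"]
  by (force simp: o_def strip_def intro!: holomorphic_intros)

section \<open>Rectangles covering one period, and bounds on closed substrips\<close>

lemma compact_rectangle: "compact {z. Re z \<in> {c..d} \<and> Im z \<in> {a..b}}"
proof -
  have "{z. Re z \<in> {c..d} \<and> Im z \<in> {a..b}} = cbox (Complex c a) (Complex d b)"
    by (auto simp: in_cbox_complex_iff)
  then show ?thesis by simp
qed

lemma rectangle_subset_strip:
  assumes "- \<rho> < a" "b < \<rho>"
  shows "{z. Re z \<in> {c..d} \<and> Im z \<in> {a..b}} \<subseteq> strip \<rho>"
  using assms by (auto simp: strip_def)

lemma periodic_bounded_on_substrip:
  assumes hol: "V holomorphic_on strip \<rho>" and per: "\<And>z. V (z + 1) = V z"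
    and ab: "- \<rho> < a" "b < \<rho>"
  obtains S where "S > 0" "\<And>z. Im z \<in> {a..b} \<Longrightarrow> norm (V z) \<le> S"
proof -
  let ?K = "{z. Re z \<in> {0..1} \<and> Im z \<in> {a..b}}"
  have "continuous_on ?K V"
    using hol rectangle_subset_strip[OF ab]
    by (meson holomorphic_on_imp_continuous_on continuous_on_subset)
  then have "bounded (V ` ?K)"
    using compact_rectangle by (intro compact_imp_bounded compact_continuous_image)
  then obtain S where S: "S > 0" "\<And>z. z \<in> ?K \<Longrightarrow> norm (V z) \<le> S"
    unfolding bounded_pos by blast
  have "norm (V z) \<le> S" if "Im z \<in> {a..b}" for z
    using S(2)[of "Complex (frac (Re z)) (Im z)"] periodic_frac[of V z, OF per] that
    by (simp add: less_imp_le[OF frac_lt_1])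
  with S(1) show ?thesis using that by blast
qed

text \<open>A non-constant holomorphic function takes the value \<open>w\<close> only finitely often
  in a compact rectangle, so only finitely many heights are excluded.\<close>

lemma line_avoiding_value:
  assumes hol: "V holomorphic_on strip \<rho>" and nc: "\<not> V constant_on strip \<rho>"
    and ab: "- \<rho> < a" "a < b" "b < \<rho>"
  obtains y where "a < y" "y < b" "\<And>z. Re z \<in> {0..1} \<Longrightarrow> Im z = y \<Longrightarrow> V z \<noteq> w"
proof -
  let ?K = "{z. Re z \<in> {0..1} \<and> Im z \<in> {a..b}}"
  have "\<not> (\<lambda>z. V z - w) constant_on strip \<rho>"
    using nc unfolding constant_on_def by (metis diff_add_cancel)
  then have fin: "finite {z \<in> ?K. V z - w = 0}"
    using rectangle_subset_strip[of \<rho> a b] ab hol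
    by (intro holomorphic_compact_finite_zeros[where S="strip \<rho>"] compact_rectangle)
       (auto intro!: holomorphic_intros simp: open_strip connected_strip)
  have "infinite {a<..<b}"
    using ab by (intro infinite_Ioo)
  then obtain y where y: "y \<in> {a<..<b}" "y \<notin> Im ` {z \<in> ?K. V z - w = 0}"
    using finite_imageI[OF fin, of Im] by (meson finite_subset subsetI)
  then have "V z \<noteq> w" if "Re z \<in> {0..1}" "Im z = y" for z
    using that by force
  with y show ?thesis using that[of y] by simp
qed

text \<open>Avoidance is stable: by uniform continuity it persists for nearby heights and nearby
  values, with a quantitative gap. Having one gap for an open set of values prepares the compactness
  argument over \<open>w\<close>.\<close>

lemma substrip_avoiding_value:
  assumes hol: "V holomorphic_on strip \<rho>" and per: "\<And>z. V (z + 1) = V z"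
    and nc: "\<not> V constant_on strip \<rho>"
    and ab: "- \<rho> < a" "a < b" "b < \<rho>"
  obtains a' b' e where "a \<le> a'" "a' < b'" "b' \<le> b" "e > 0"
    "\<And>w z. w \<in> ball w0 e \<Longrightarrow> Im z \<in> {a'..b'} \<Longrightarrow> e \<le> norm (V z - w)"
proof -
  let ?K = "{z. Re z \<in> {0..1} \<and> Im z \<in> {a..b}}"
  obtain y where y: "a < y" "y < b"
    and avoid: "\<And>z. Re z \<in> {0..1} \<Longrightarrow> Im z = y \<Longrightarrow> V z \<noteq> w0"
    using line_avoiding_value[OF hol nc ab, of w0] by blast
  have cont: "continuous_on ?K V"
    using hol rectangle_subset_strip[of \<rho> a b] ab
    by (meson holomorphic_on_imp_continuous_on continuous_on_subset)
  let ?L = "{z. Re z \<in> {0..1} \<and> Im z \<in> {y..y}}"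
  have LK: "?L \<subseteq> ?K"
    using y by auto
  have "Complex 0 y \<in> ?L"
    by simp
  then have "?L \<noteq> {}"
    by blast
  then obtain z0 where z0: "z0 \<in> ?L" "\<And>z. z \<in> ?L \<Longrightarrow> norm (V z0 - w0) \<le> norm (V z - w0)"
    using continuous_attains_inf[of ?L "\<lambda>z. norm (V z - w0)"] compact_rectangle
      continuous_on_subset[OF cont LK] by (fastforce intro!: continuous_intros)
  \<comment> \<open>One third of the distance is lost in moving the height, one third in moving from
    \<open>w0\<close> to \<open>w\<close>, and one third remains.\<close>
  define e where "e = norm (V z0 - w0) / 3"
  have e: "e > 0"
    using z0(1) avoid[of z0] by (simp add: e_def)
  have "uniformly_continuous_on ?K V"
    using cont compact_rectangle by (rule compact_uniformly_continuous)
  then have "\<exists>d>0. \<forall>z\<in>?K. \<forall>z'\<in>?K. dist z' z < d \<longrightarrow> dist (V z') (V z) < e"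
    using e by (simp only: uniformly_continuous_on_def)
  then obtain d where d: "d > 0"
    and unif: "\<And>z z'. z \<in> ?K \<Longrightarrow> z' \<in> ?K \<Longrightarrow> dist z' z < d \<Longrightarrow> dist (V z') (V z) < e"
    by blast
  define b' where "b' = min b (y + d/2)"
  have "e \<le> norm (V z - w)" if w: "w \<in> ball w0 e" and z: "Im z \<in> {y..b'}" for w z
  proof -
    let ?z = "Complex (frac (Re z)) (Im z)" and ?u = "Complex (frac (Re z)) y"
    have "?z - ?u = \<i> * of_real (Im z - y)"
      by (simp add: complex_eq_iff)
    then have "dist ?z ?u = \<bar>Im z - y\<bar>"
      by (simp add: dist_norm norm_mult del: of_real_diff)
    also have "\<dots> < d"
      using z d by (auto simp: b'_def)
    finally have "dist (V ?z) (V ?u) < e"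
      using z y by (intro unif) (auto simp: b'_def less_imp_le[OF frac_lt_1])
    moreover have "3 * e \<le> norm (V ?u - w0)"
      using z0(2)[of ?u] by (simp add: e_def less_imp_le[OF frac_lt_1])
    moreover have "norm (V ?u - w0) \<le> dist (V ?z) (V ?u) + norm (V ?z - w) + dist w0 w"
      unfolding dist_norm by norm
    ultimately have "e \<le> norm (V ?z - w)"
      using w by simp
    then show ?thesis
      using periodic_frac[of V z, OF per] by simp
  qed
  then show ?thesis
    using that[of y b' e] y d e by (auto simp: b'_def)
qed

text \<open>Compactness of a disc of values leaves finitely many substrips. Values outside that disc
  are far from the range of \<open>V\<close> on all of \<open>{a..b}\<close>, at a distance
  comparable to their modulus, which explains the factor \<open>max 1 (norm w)\<close>.\<close>

lemma finitely_many_substrips_avoiding_value: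
  fixes V :: "complex \<Rightarrow> complex"
  assumes hol: "V holomorphic_on strip \<rho>" and per: "\<And>z. V (z + 1) = V z"
    and nc: "\<not> V constant_on strip \<rho>"
    and ab: "- \<rho> < a" "a < b" "b < \<rho>"
  obtains J c where "finite J" "c > 0"
    "\<And>a' b'. (a', b') \<in> J \<Longrightarrow> a \<le> a' \<and> a' < b' \<and> b' \<le> b"
    "\<And>w. \<exists>(a', b') \<in> J. \<forall>z. Im z \<in> {a'..b'} \<longrightarrow> c * max 1 (norm w) \<le> norm (V z - w)"
proof -
  obtain S where S: "S > 0" "\<And>z. Im z \<in> {a..b} \<Longrightarrow> norm (V z) \<le> S"
    using periodic_bounded_on_substrip[OF hol per, of a b] ab by auto
  \<comment> \<open>For \<open>norm w > R\<close> the bound \<open>S\<close> is below half of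
    \<open>norm w\<close>, so the whole strip avoids \<open>w\<close> by at least
    \<open>norm w / 2\<close>. Also \<open>R\<close> is at least 1, so it bounds
    \<open>max 1 (norm w)\<close> on the disc.\<close>
  define R where "R = 2 * S + 1"
  have "\<exists>a' b' e. a \<le> a' \<and> a' < b' \<and> b' \<le> b \<and> e > 0 \<and>
      (\<forall>w z. w \<in> ball w0 e \<longrightarrow> Im z \<in> {a'..b'} \<longrightarrow> e \<le> norm (V z - w))" for w0
    by (rule substrip_avoiding_value[OF hol per nc ab, of w0]) blast
  then obtain \<alpha> \<beta> \<epsilon> where *: "\<And>w0. a \<le> \<alpha> w0 \<and> \<alpha> w0 < \<beta> w0 \<and> \<beta> w0 \<le> b \<and> \<epsilon> w0 > 0"
    and **: "\<And>w0 w z. w \<in> ball w0 (\<epsilon> w0) \<Longrightarrow> Im z \<in> {\<alpha> w0..\<beta> w0} \<Longrightarrow> \<epsilon> w0 \<le> norm (V z - w)"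
    by metis
  have "cball 0 R \<subseteq> (\<Union>w\<in>UNIV. ball w (\<epsilon> w))"
    using * by (auto intro!: exI centre_in_ball[THEN iffD2])
  then obtain D where D: "finite D" "cball 0 R \<subseteq> (\<Union>w\<in>D. ball w (\<epsilon> w))"
    using compactE_image[of "cball (0::complex) R" UNIV "\<lambda>w. ball w (\<epsilon> w)"] compact_cball open_ball
    by metis
  \<comment> \<open>The full interval \<open>(a, b)\<close> is included for the values of modulus
    above \<open>R\<close>.\<close>
  define J where "J = insert (a, b) ((\<lambda>w. (\<alpha> w, \<beta> w)) ` D)"
  define e where "e = Min (insert 1 (\<epsilon> ` D))"
  have e: "e > 0" "\<And>w. w \<in> D \<Longrightarrow> e \<le> \<epsilon> w"
    using D(1) * by (auto simp: e_def)
  \<comment> \<open>The entry \<open>1/2\<close> serves the large values; \<open>e / R\<close>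
    serves the disc, where \<open>max 1 (norm w)\<close> is at most \<open>R\<close>.\<close>
  define c where "c = min (1/2) (e / R)"
  have R: "R \<ge> 1"
    using S(1) by (simp add: R_def)
  have c: "c > 0"
    using R e by (simp add: c_def)
  have c_le: "c \<le> 1/2" "c \<le> e / R"
    unfolding c_def by (rule min.cobounded1, rule min.cobounded2)
  have "\<exists>(a', b') \<in> J. \<forall>z. Im z \<in> {a'..b'} \<longrightarrow> c * max 1 (norm w) \<le> norm (V z - w)" for w
  proof (cases "norm w \<le> R")
    case True
    then have "w \<in> cball 0 R"
      by simp
    then obtain w0 where w0: "w0 \<in> D" "w \<in> ball w0 (\<epsilon> w0)"
      using D(2) by blast
    have "c * max 1 (norm w) \<le> (e / R) * R"
      using True R e c_le by (intro mult_mono) auto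
    also have "\<dots> \<le> \<epsilon> w0"
      using R e(2)[OF w0(1)] by simp
    finally have "\<forall>z. Im z \<in> {\<alpha> w0..\<beta> w0} \<longrightarrow> c * max 1 (norm w) \<le> norm (V z - w)"
      using **[OF w0(2)] by force
    then show ?thesis
      using w0(1) by (auto simp: J_def)
  next
    case False
    have "c * max 1 (norm w) \<le> norm (V z - w)" if "Im z \<in> {a..b}" for z
    proof -
      have "c * max 1 (norm w) \<le> (1/2) * norm w"
        using False R c_le by (intro mult_mono) auto
      also have "\<dots> \<le> norm w - norm (V z)"
        using False S(2)[OF that] by (simp add: R_def)
      also have "\<dots> \<le> norm (V z - w)"
        by norm
      finally show ?thesis .
    qed
    then show ?thesis
      by (auto simp: J_def)
  qed
  moreover have "finite J"
    using D by (simp add: J_def)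
  moreover have "a \<le> a' \<and> a' < b' \<and> b' \<le> b" if "(a', b') \<in> J" for a' b'
    using that * ab by (auto simp: J_def)
  ultimately show ?thesis
    using that c by blast
qed

text \<open>Nested substrips, by induction on \<open>q\<close>: one value of \<open>W\<close>
  selects a substrip from a finite list, and the remaining values are avoided on a line inside it.
  The list depends on \<open>V\<close> and the strip but not on \<open>W\<close>, so a minimum over
  it gives a constant independent of \<open>W\<close>.\<close>

lemma line_avoiding_values:
  assumes hol: "V holomorphic_on strip \<rho>" and per: "\<And>z. V (z + 1) = V z"
    and nc: "\<not> V constant_on strip \<rho>"
    and ab: "- \<rho> < a" "a < b" "b < \<rho>"
  shows "\<exists>c>0. \<forall>W. finite W \<and> card W \<le> q \<longrightarrow>
    (\<exists>y\<in>{a..b}. \<forall>w\<in>W. \<forall>z. Im z = y \<longrightarrow> c * max 1 (norm w) \<le> norm (V z - w))"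
  using ab
proof (induction q arbitrary: a b)
  case 0
  then have "a \<in> {a..b}"
    by simp
  then show ?case
    by (intro exI[of _ 1]) auto
next
  case (Suc q)
  obtain J c where J: "finite J" "c > 0"
      "\<And>a' b'. (a', b') \<in> J \<Longrightarrow> a \<le> a' \<and> a' < b' \<and> b' \<le> b"
    and cover: "\<And>w. \<exists>(a', b') \<in> J. \<forall>z. Im z \<in> {a'..b'} \<longrightarrow> c * max 1 (norm w) \<le> norm (V z - w)"
    by (rule finitely_many_substrips_avoiding_value[OF hol per nc Suc.prems]) blast
  have "\<exists>c>0. \<forall>W. finite W \<and> card W \<le> q \<longrightarrow>
    (\<exists>y\<in>{fst I..snd I}. \<forall>w\<in>W. \<forall>z. Im z = y \<longrightarrow> c * max 1 (norm w) \<le> norm (V z - w))"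
    if "I \<in> J" for I
    using J(3)[of "fst I" "snd I"] that Suc.prems by (intro Suc.IH) auto
  then obtain \<gamma> where \<gamma>: "\<And>I. I \<in> J \<Longrightarrow> \<gamma> I > 0"
    and avoid: "\<And>I W. I \<in> J \<Longrightarrow> finite W \<Longrightarrow> card W \<le> q \<Longrightarrow>
      \<exists>y\<in>{fst I..snd I}. \<forall>w\<in>W. \<forall>z. Im z = y \<longrightarrow> \<gamma> I * max 1 (norm w) \<le> norm (V z - w)"
    by metis
  \<comment> \<open>The first constant handles the value that selects the substrip, the others
    handle the remaining values inside each possible substrip.\<close>
  define c' where "c' = Min (insert c (\<gamma> ` J))"
  have c': "c' > 0" "c' \<le> c" "\<And>I. I \<in> J \<Longrightarrow> c' \<le> \<gamma> I"
    using J \<gamma> by (auto simp: c'_def)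
  have weaken: "c' * max 1 (norm w) \<le> t" if "k * max 1 (norm w) \<le> t" "c' \<le> k" for k t and w :: complex
    using that by (smt (verit) mult_right_mono)
  have "\<exists>y\<in>{a..b}. \<forall>w\<in>W. \<forall>z. Im z = y \<longrightarrow> c' * max 1 (norm w) \<le> norm (V z - w)"
    if W: "finite W" "card W \<le> Suc q" for W
  proof (cases "W = {}")
    case True
    moreover have "a \<in> {a..b}"
      using Suc.prems by simp
    ultimately show ?thesis by blast
  next
    case False
    then obtain w where w: "w \<in> W" by blast
    then obtain I where I: "I \<in> J"
      and Iw: "\<And>z. Im z \<in> {fst I..snd I} \<Longrightarrow> c * max 1 (norm w) \<le> norm (V z - w)"
      using cover[of w] by fastforce
    have "card (W - {w}) \<le> q"
      using W w by simp
    then obtain y where y: "y \<in> {fst I..snd I}"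
      and yW: "\<And>u z. u \<in> W - {w} \<Longrightarrow> Im z = y \<Longrightarrow> \<gamma> I * max 1 (norm u) \<le> norm (V z - u)"
      using avoid[OF I, of "W - {w}"] W by blast
    have "c' * max 1 (norm u) \<le> norm (V z - u)" if "u \<in> W" "Im z = y" for u z
    proof (cases "u = w")
      case True
      then show ?thesis using Iw[of z] y that c' weaken by blast
    next
      case False
      then show ?thesis using yW[of u z] that c'(3)[OF I] weaken by blast
    qed
    moreover have "y \<in> {a..b}"
      using J(3)[of "fst I" "snd I"] I y by auto
    ultimately show ?thesis by blast
  qed
  with c'(1) show ?case by blast
qed

section \<open>Convexity of logarithmic means\<close>

text \<open>Hadamard's three lines theorem. Periodicity replaces a growth condition at infinity: the
  supremum over the closed strip is attained in one period.\<close>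

lemma three_lines_periodic:
  fixes G :: "complex \<Rightarrow> complex"
  assumes hol: "G holomorphic_on strip \<rho>" and per: "\<And>z. G (z + 1) = G z"
    and h: "0 < h" "h < \<rho>"
    and bottom: "\<And>z. Im z = 0 \<Longrightarrow> norm (G z) \<le> exp \<alpha>"
    and top: "\<And>z. Im z = h \<Longrightarrow> norm (G z) \<le> exp \<beta>"
    and z: "0 \<le> Im z" "Im z \<le> h"
  shows "norm (G z) \<le> exp (\<alpha> + (\<beta> - \<alpha>) * Im z / h)"
proof -
  define \<phi> where "\<phi> z = \<alpha> + (\<beta> - \<alpha>) * Im z / h" for z
  \<comment> \<open>The real part of \<open>- \<i> * z\<close> is \<open>Im z\<close>, so the
    exponential factor has modulus \<open>exp (- \<phi> z)\<close>. Although \<open>g\<close> itself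
    need not be 1-periodic, its modulus is.\<close>
  define g where "g z = G z * exp (- (of_real \<alpha> + of_real ((\<beta> - \<alpha>) / h) * (- \<i> * z)))" for z
  have norm_g: "norm (g z) = norm (G z) * exp (- \<phi> z)" for z
    by (simp add: g_def \<phi>_def norm_mult)
  have per_g: "norm (g z) = norm (g (Complex (frac (Re z)) (Im z)))" for z
    using periodic_frac[of G z, OF per] by (simp add: norm_g \<phi>_def)
  have hol_g: "g holomorphic_on strip \<rho>"
    unfolding g_def by (intro holomorphic_intros hol)
  let ?K = "{z. Re z \<in> {0..1} \<and> Im z \<in> {0..h}}"
  have K: "?K \<subseteq> strip \<rho>"
    using h by (intro rectangle_subset_strip) auto
  have "Complex 0 0 \<in> ?K"
    using h by simp
  then have "?K \<noteq> {}"
    by blast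
  moreover have "continuous_on ?K (\<lambda>z. norm (g z))"
    by (intro continuous_on_norm continuous_on_subset[OF _ K] holomorphic_on_imp_continuous_on hol_g)
  ultimately obtain z0 where z0: "z0 \<in> ?K" "\<And>z. z \<in> ?K \<Longrightarrow> norm (g z) \<le> norm (g z0)"
    using continuous_attains_sup compact_rectangle by meson
  have max: "norm (g z) \<le> norm (g z0)" if "Im z \<in> {0..h}" for z
    using z0(2)[of "Complex (frac (Re z)) (Im z)"] that
    by (simp add: per_g[of z] less_imp_le[OF frac_lt_1])
  have edges: "norm (g z) \<le> 1" if "Im z = 0 \<or> Im z = h" for z
    using that bottom[of z] top[of z] h by (auto simp: norm_g \<phi>_def exp_minus divide_inverse[symmetric])
  have "norm (g z0) \<le> 1"
  proof (cases "Im z0 = 0 \<or> Im z0 = h")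
    case True
    then show ?thesis by (rule edges)
  next
    case False
    then have Im: "0 < Im z0" "Im z0 < h"
      using z0 by auto
    define U where "U = {z. 0 < Im z \<and> Im z < h}"
    have "open U"
      unfolding U_def by (intro open_Collect_conj open_Collect_less continuous_intros)
    moreover have "U \<subseteq> strip \<rho>"
      using h by (auto simp: U_def strip_def)
    \<comment> \<open>An interior maximum forces \<open>g\<close> to be constant, and its value can
      then be read off at 0 on the bottom edge.\<close>
    ultimately have "g constant_on strip \<rho>"
      using Im by (intro maximum_modulus_principle[OF hol_g open_strip connected_strip, of U z0])
        (auto simp: U_def intro: max)
    moreover have "0 \<in> strip \<rho>" "z0 \<in> strip \<rho>"
      using h Im by (auto simp: strip_def)
    ultimately have "g z0 = g 0"
      by (metis constant_on_def)
    then show ?thesis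
      using edges[of 0] by simp
  qed
  then have "norm (g z) \<le> 1"
    using max[of z] z by simp
  then have "norm (G z) \<le> exp (\<phi> z)"
    by (simp add: norm_g exp_minus divide_inverse[symmetric])
  then show ?thesis
    by (simp add: \<phi>_def)
qed

section \<open>Riemann sums with a uniform error\<close>

lemma sum_integral_subintervals:
  fixes \<phi> :: "real \<Rightarrow> real"
  assumes m: "m > 0" and int: "\<phi> integrable_on {0..1}" and k: "k \<le> m"
  shows "(\<Sum>j<k. integral {real j / real m..real (Suc j) / real m} \<phi>) = integral {0..real k / real m} \<phi>"
  using k
proof (induction k)
  case 0
  then show ?case by simp
next
  case (Suc k)
  have "integral {0..real k / real m} \<phi> + integral {real k / real m..real (Suc k) / real m} \<phi>
      = integral {0..real (Suc k) / real m} \<phi>"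
    using m Suc.prems
    by (intro Henstock_Kurzweil_Integration.integral_combine integrable_on_subinterval[OF int])
       (auto simp: divide_simps)
  with Suc show ?case by simp
qed

text \<open>For \<open>x\<close> in the first cell, \<open>x + j/m\<close> lies in the cell of index
  \<open>j\<close>, so uniform continuity compares each sample with the mean over its cell. One
  \<open>m\<close> must serve all \<open>x\<close>, since a pointwise bound on the real axis is
  wanted later.\<close>

lemma riemann_sums_uniform:
  fixes \<phi> :: "real \<Rightarrow> real"
  assumes cont: "continuous_on {0..1} \<phi>" and e: "e > 0"
  obtains m where "m > 0"
    "\<And>x. x \<in> {0..1 / real m} \<Longrightarrow> (\<Sum>j<m. \<phi> (x + real j / real m)) \<le> real m * (integral {0..1} \<phi> + e)"
proof -
  have "uniformly_continuous_on {0..1} \<phi>"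
    using cont by (rule compact_uniformly_continuous) simp
  then obtain d where d: "d > 0"
    and unif: "\<And>s t. s \<in> {0..1} \<Longrightarrow> t \<in> {0..1} \<Longrightarrow> \<bar>s - t\<bar> < d \<Longrightarrow> \<bar>\<phi> s - \<phi> t\<bar> < e"
    using e unfolding uniformly_continuous_on_def dist_real_def by metis
  obtain m :: nat where "1 / d < m"
    using reals_Archimedean2 by blast
  moreover then have m: "m > 0"
    using d by (cases m) (auto simp: not_less[symmetric])
  ultimately have md: "1 / real m < d"
    using d by (simp add: field_simps)
  have int: "\<phi> integrable_on {0..1}"
    using cont by (rule integrable_continuous_real)
  have "(\<Sum>j<m. \<phi> (x + real j / real m)) \<le> real m * (integral {0..1} \<phi> + e)"
    if x: "x \<in> {0..1 / real m}" for x
  proof -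
    have "(\<phi> (x + real j / real m) - e) / real m
        \<le> integral {real j / real m..real (Suc j) / real m} \<phi>" if j: "j < m" for j
    proof -
      let ?I = "{real j / real m..real (Suc j) / real m}"
      have "real (Suc j) / real m \<le> 1"
        using j by simp
      moreover have "real j / real m \<ge> 0"
        by simp
      ultimately have sub: "?I \<subseteq> {0..1}"
        by (meson atLeastatMost_subset_iff)
      have x': "x + real j / real m \<in> ?I"
        using x by (simp add: add_divide_distrib)
      have "\<phi> (x + real j / real m) - e \<le> \<phi> t" if t: "t \<in> ?I" for t
      proof -
        have "\<bar>x + real j / real m - t\<bar> \<le> 1 / real m"
          using t x by (auto simp: add_divide_distrib abs_le_iff)
        then have "\<bar>\<phi> (x + real j / real m) - \<phi> t\<bar> < e"
          using x' t sub md by (intro unif subsetD[OF sub]) auto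
        then show ?thesis by simp
      qed
      then have "integral ?I (\<lambda>t. \<phi> (x + real j / real m) - e) \<le> integral ?I \<phi>"
        using integrable_on_subinterval[OF int sub] by (intro integral_le) auto
      then show ?thesis
        by (simp add: divide_right_mono diff_divide_distrib[symmetric] field_simps)
    qed
    then have "(\<Sum>j<m. (\<phi> (x + real j / real m) - e) / real m)
        \<le> (\<Sum>j<m. integral {real j / real m..real (Suc j) / real m} \<phi>)"
      by (intro sum_mono) simp
    also have "\<dots> = integral {0..1} \<phi>"
      using sum_integral_subintervals[OF m int, of m] m by simp
    finally have "((\<Sum>j<m. \<phi> (x + real j / real m)) - real m * e) / real m \<le> integral {0..1} \<phi>"
      by (simp add: sum_subtractf flip: sum_divide_distrib)
    then show ?thesis
      using m by (simp add: field_simps)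
  qed
  with m show ?thesis using that by blast
qed

text \<open>Subharmonicity in integrated form. Replacing \<open>f\<close> by the product of its translates by
  multiples of \<open>1/m\<close> turns the integral mean over the real axis into a pointwise bound,
  so that the three lines theorem applies.\<close>

lemma log_norm_mean_bound:
  fixes f :: "complex \<Rightarrow> complex"
  assumes hol: "f holomorphic_on strip \<rho>" and per: "\<And>z. f (z + 1) = f z"
    and y: "0 < y" "y \<le> h" "h < \<rho>"
    and cont: "continuous_on {0..1} \<phi>"
    and bottom: "\<And>x. x \<in> {0..1} \<Longrightarrow> norm (f (of_real x)) \<le> exp (\<phi> x)"
    and middle: "\<And>z. Im z = y \<Longrightarrow> exp \<alpha> \<le> norm (f z)"
    and top: "\<And>z. Im z = h \<Longrightarrow> norm (f z) \<le> exp \<beta>"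
  shows "\<alpha> \<le> (1 - y / h) * integral {0..1} \<phi> + y / h * \<beta>"
proof -
  define I where "I = integral {0..1} \<phi>"
  have bound: "\<alpha> \<le> (I + e) + (\<beta> - (I + e)) * y / h" if e: "e > 0" for e
  proof -
    obtain m where m: "m > 0"
      and rs: "\<And>x. x \<in> {0..1 / real m} \<Longrightarrow> (\<Sum>j<m. \<phi> (x + real j / real m)) \<le> real m * (I + e)"
      using riemann_sums_uniform[OF cont e] unfolding I_def by metis
    define G where "G z = (\<Prod>j<m. f (z + of_real (real j / real m)))" for z
    have hol_G: "G holomorphic_on strip \<rho>"
      unfolding G_def by (intro holomorphic_intros holomorphic_on_strip_translate hol)
    \<comment> \<open>Multiplying the shifted product by \<open>f z\<close>, or \<open>G z\<close>
      by \<open>f (z + 1)\<close>, gives the same product of \<open>m + 1\<close> factors.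
      Cancelling \<open>f z\<close> fails at its zeros, where both products vanish directly.\<close>
    have per_G: "G (z + of_real (1 / real m)) = G z" for z
    proof -
      have "G (z + of_real (1 / real m)) = (\<Prod>j<m. f (z + of_real (real (Suc j) / real m)))"
        by (simp add: G_def add_divide_distrib algebra_simps)
      also have "\<dots> * f z = (\<Prod>j<Suc m. f (z + of_real (real j / real m)))"
        by (subst prod.lessThan_Suc_shift) (simp add: mult.commute)
      also have "\<dots> = G z * f (z + 1)"
        using m by (simp add: G_def)
      finally have *: "G (z + of_real (1 / real m)) * f z = G z * f z"
        by (simp add: per)
      show ?thesis
      proof (cases "f z = 0")
        case False
        then show ?thesis using * by simp
      next
        case True
        then have "G z = 0"
          using m by (auto simp: G_def intro!: bexI[of _ 0])
        \<comment> \<open>The last factor of the shifted product is \<open>f (z + 1)\<close>, which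
          equals \<open>f z\<close>.\<close>
        moreover have "f (z + of_real (1 / real m) + of_real (real (m - 1) / real m)) = 0"
          using m True per[of z] by (simp add: of_nat_diff diff_divide_distrib)
        then have "G (z + of_real (1 / real m)) = 0"
          using m by (auto simp: G_def intro!: bexI[of _ "m - 1"])
        ultimately show ?thesis by simp
      qed
    qed
    interpret G: periodic_fun_simple G "complex_of_real (1 / real m)"
      by standard (rule per_G)
    have "G (z + 1) = G z" for z
      using G.plus_of_nat[of z m] m by simp
    moreover have "norm (G z) \<le> exp (real m * (I + e))" if "Im z = 0" for z
    proof -
      \<comment> \<open>Periodicity with period \<open>1/m\<close> moves a real point into the first
        cell, where the Riemann sum estimate holds.\<close>
      define n where "n = \<lfloor>Re z * real m\<rfloor>"
      define x where "x = Re z - of_int n / real m"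
      have "of_int n \<le> Re z * real m" "Re z * real m < of_int n + 1"
        unfolding n_def by linarith+
      moreover have "x = (Re z * real m - of_int n) / real m"
        using m by (simp add: x_def diff_divide_distrib)
      ultimately have x: "x \<in> {0..1 / real m}"
        by (simp add: divide_right_mono)
      have "z = of_real x + of_int n * of_real (1 / real m)"
        using that by (simp add: complex_eq_iff x_def)
      then have "norm (G z) = norm (G (of_real x))"
        using G.plus_of_int[of "of_real x" n] by simp
      also have "\<dots> = (\<Prod>j<m. norm (f (of_real (x + real j / real m))))"
        by (simp add: G_def prod_norm)
      also have "\<dots> \<le> (\<Prod>j<m. exp (\<phi> (x + real j / real m)))"
      proof (intro prod_mono conjI norm_ge_zero bottom)
        fix j assume "j \<in> {..<m}"
        then have "real j + 1 \<le> real m"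
          by simp
        then have "1 / real m + real j / real m \<le> 1"
          using m by (simp add: field_simps)
        moreover have "real j / real m \<ge> 0"
          by simp
        ultimately show "x + real j / real m \<in> {0..1}"
          using x by auto
      qed
      also have "\<dots> \<le> exp (real m * (I + e))"
        using rs[OF x] by (simp add: exp_sum[symmetric])
      finally show ?thesis .
    qed
    moreover have "norm (G z) \<le> exp (real m * \<beta>)" if "Im z = h" for z
    proof -
      have "norm (G z) \<le> (\<Prod>j<m. exp \<beta>)"
        unfolding G_def prod_norm[symmetric] using that by (intro prod_mono conjI norm_ge_zero top) simp
      then show ?thesis
        by (simp add: exp_of_nat_mult)
    qed
    ultimately have "norm (G (Complex 0 y)) \<le>
        exp (real m * (I + e) + (real m * \<beta> - real m * (I + e)) * Im (Complex 0 y) / h)"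
      using y by (intro three_lines_periodic[OF hol_G]) auto
    moreover have "exp (real m * \<alpha>) \<le> norm (G (Complex 0 y))"
    proof -
      have "(\<Prod>j<m. exp \<alpha>) \<le> norm (G (Complex 0 y))"
        unfolding G_def prod_norm[symmetric] by (intro prod_mono conjI middle) simp_all
      then show ?thesis
        by (simp add: exp_of_nat_mult)
    qed
    ultimately have "exp (real m * \<alpha>) \<le> exp (real m * (I + e) + (real m * \<beta> - real m * (I + e)) * y / h)"
      by (simp only: complex.sel)
    then have "real m * \<alpha> \<le> real m * ((I + e) + (\<beta> - (I + e)) * y / h)"
      by (simp add: algebra_simps)
    then show ?thesis
      using m by simp
  qed
  \<comment> \<open>The error enters with coefficient \<open>1 - y / h\<close>, which is at most 1,
    so letting \<open>e\<close> tend to 0 removes it.\<close>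
  have "\<alpha> \<le> (1 - y / h) * I + y / h * \<beta> + e" if e: "e > 0" for e
  proof -
    have "(I + e) + (\<beta> - (I + e)) * y / h = (1 - y / h) * I + y / h * \<beta> + (1 - y / h) * e"
      by (simp add: algebra_simps diff_divide_distrib add_divide_distrib)
    moreover have "(1 - y / h) * e \<le> 1 * e"
      using y e by (intro mult_right_mono) auto
    ultimately show ?thesis
      using bound[OF e] by linarith
  qed
  then show ?thesis
    unfolding I_def by (rule field_le_epsilon)
qed

section \<open>Continuants and transfer matrices\<close>

text \<open>The determinant of the tridiagonal matrix with diagonal \<open>a 1\<close>, ...,
  \<open>a n\<close> and off-diagonal entries 1. The general ring lets one definition serve the real
  matrix entries and their complex extension.\<close>

fun continuant :: "(nat \<Rightarrow> 'a::comm_ring_1) \<Rightarrow> nat \<Rightarrow> 'a" where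
  "continuant a 0 = 1"
| "continuant a (Suc 0) = a 1"
| "continuant a (Suc (Suc n)) = a (Suc (Suc n)) * continuant a (Suc n) - continuant a n"

lemma continuant_of_real:
  "continuant (\<lambda>k. of_real (a k)) n = (of_real (continuant a n) :: 'a::{comm_ring_1,real_algebra_1})"
  by (induction a n rule: continuant.induct) auto

lemma continuant_holomorphic_on:
  assumes "\<And>k. (\<lambda>z. a z k) holomorphic_on S"
  shows "(\<lambda>z. continuant (a z) n) holomorphic_on S"
  by (induction n rule: induct_nat_012) (auto intro!: holomorphic_intros assms)

text \<open>The hypothesis forces \<open>u k\<close> to be at least 1, so the products do not
  decrease and the subtracted continuant is absorbed by the summand 1.\<close>

lemma norm_continuant_le:
  fixes a :: "nat \<Rightarrow> 'a::{comm_ring_1,real_normed_algebra_1}"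
  assumes "\<And>k. norm (a k) + 1 \<le> u k"
  shows "norm (continuant a n) \<le> (\<Prod>k=1..n. u k)"
proof (induction n rule: induct_nat_012)
  case 1
  show ?case using assms[of 1] by simp
next
  case (ge2 n)
  have u: "u k \<ge> 1" for k
    using assms[of k] norm_ge_zero[of "a k"] by linarith
  let ?P = "\<lambda>n. \<Prod>k=1..n. u k"
  have P: "?P n \<ge> 0" for n
    using u by (intro prod_nonneg) (meson order_trans zero_le_one)
  have "?P n * 1 \<le> ?P n * u (Suc n)"
    using u P by (intro mult_left_mono)
  then have mono: "?P n \<le> ?P (Suc n)"
    by simp
  have "norm (continuant a (Suc (Suc n))) \<le> norm (a (Suc (Suc n)) * continuant a (Suc n)) + norm (continuant a n)"
    by (simp add: norm_triangle_ineq4)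
  also have "\<dots> \<le> norm (a (Suc (Suc n))) * norm (continuant a (Suc n)) + norm (continuant a n)"
    by (simp add: norm_mult_ineq)
  also have "\<dots> \<le> norm (a (Suc (Suc n))) * ?P (Suc n) + ?P (Suc n)"
    using ge2 mono by (intro add_mono mult_left_mono) auto
  also have "\<dots> = (norm (a (Suc (Suc n))) + 1) * ?P (Suc n)"
    by (simp add: algebra_simps)
  also have "\<dots> \<le> u (Suc (Suc n)) * ?P (Suc n)"
    using assms P by (intro mult_right_mono)
  finally show ?case
    by (simp add: mult_ac)
qed simp

text \<open>As long as the moduli do not decrease, subtracting the earlier continuant costs at most
  1 in the growth factor.\<close>

lemma norm_continuant_ge:
  fixes a :: "nat \<Rightarrow> 'a::{comm_ring_1,real_normed_div_algebra}"
  assumes l: "\<And>k. l k + 1 \<le> norm (a k)" "\<And>k. l k \<ge> 1"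
  shows "norm (continuant a n) \<ge> (\<Prod>k=1..n. l k)"
proof -
  \<comment> \<open>The induction needs the ratio of consecutive moduli, not just the product bound,
    since the recursion involves two earlier terms.\<close>
  have step: "l (Suc n) * norm (continuant a n) \<le> norm (continuant a (Suc n))" for n
  proof (induction n)
    case 0
    then show ?case using l(1)[of 1] by simp
  next
    case (Suc n)
    let ?D = "\<lambda>n. norm (continuant a n)"
    have "1 * ?D n \<le> l (Suc n) * ?D n"
      using l(2) by (intro mult_right_mono) auto
    with Suc have "?D n \<le> ?D (Suc n)"
      by linarith
    moreover have "(l (Suc (Suc n)) + 1) * ?D (Suc n) \<le> norm (a (Suc (Suc n))) * ?D (Suc n)"
      using l(1) by (intro mult_right_mono) auto
    moreover have "norm (a (Suc (Suc n)) * continuant a (Suc n)) - ?D n \<le> ?D (Suc (Suc n))"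
      by (simp add: norm_triangle_ineq2)
    ultimately show ?case
      by (simp add: norm_mult algebra_simps)
  qed
  show ?thesis
  proof (induction n)
    case (Suc n)
    have "(\<Prod>k=1..Suc n. l k) = l (Suc n) * (\<Prod>k=1..n. l k)"
      by (simp add: mult.commute)
    also have "\<dots> \<le> l (Suc n) * norm (continuant a n)"
      using Suc l(2)[of "Suc n"] by (intro mult_left_mono) auto
    finally show ?case
      using step[of n] by linarith
  qed simp
qed

section \<open>Entries, determinant, norm and continuity of transfer matrices\<close>

lemma step_matrix_mult_nth:
  "(step_matrix v v1 lam om x E k ** A) $ 1 $ 1
     = (E - lam * v (x + real k * om) - v1 (int k)) * A $ 1 $ 1 - A $ 2 $ 1"
  "(step_matrix v v1 lam om x E k ** A) $ 2 $ 1 = A $ 1 $ 1"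
  by (simp_all add: step_matrix_def matrix_matrix_mult_def sum_2 vector_2)

text \<open>The lower entry of the first column is the upper entry one step earlier, so the matrix
  recursion becomes the three-term recursion of continuants.\<close>

lemma transfer_matrix_nth_continuant:
  "transfer_matrix v v1 lam om n x E $ 1 $ 1
     = continuant (\<lambda>k. E - lam * v (x + real k * om) - v1 (int k)) n"
  by (induction n rule: induct_nat_012) (simp_all add: step_matrix_mult_nth mat_def)

lemma det_transfer_matrix: "det (transfer_matrix v v1 lam om n x E) = 1"
proof (induction n)
  case (Suc n)
  have "det (step_matrix v v1 lam om x E (Suc n)) = 1"
    by (simp add: det_2 step_matrix_def vector_2)
  with Suc show ?case
    by (simp add: det_mul)
qed simp

lemma op_norm_pos:
  assumes "A \<noteq> 0"
  shows "op_norm A > 0"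
proof -
  have "\<not> (\<forall>u. A *v u = 0)"
    using assms matrix_eq[of A 0] by simp
  then show ?thesis
    by (simp add: op_norm_def onorm_pos_lt matrix_vector_mul_bounded_linear)
qed

text \<open>Determinant 1 excludes the zero matrix. Positivity makes the logarithm of the norm
  continuous in \<open>x\<close>.\<close>

lemma op_norm_transfer_matrix_pos: "op_norm (transfer_matrix v v1 lam om n x E) > 0"
proof -
  have "transfer_matrix v v1 lam om n x E \<noteq> 0"
    using det_transfer_matrix[of v v1 lam om n x E] by (auto simp: det_2)
  then show ?thesis by (rule op_norm_pos)
qed

lemma op_norm_diff_le: "op_norm A - op_norm B \<le> 4 * norm (A - B)"
proof -
  have "op_norm A = onorm (\<lambda>u. B *v u + (A - B) *v u)"
    by (simp add: op_norm_def matrix_vector_mult_diff_rdistrib)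
  also have "\<dots> \<le> op_norm B + op_norm (A - B)"
    unfolding op_norm_def by (intro onorm_triangle matrix_vector_mul_bounded_linear)
  also have "op_norm (A - B) \<le> real CARD(2) * real CARD(2) * norm (A - B)"
    unfolding op_norm_def
    by (intro onorm_le_matrix_component)
       (metis Finite_Cartesian_Product.norm_nth_le order_trans real_norm_def)
  finally show ?thesis by simp
qed

lemma continuous_on_op_norm: "continuous_on S op_norm"
proof (rule lipschitz_on_continuous_on)
  show "4-lipschitz_on S op_norm"
  proof (rule lipschitz_onI)
    show "dist (op_norm A) (op_norm B) \<le> 4 * dist A B" for A B
      using op_norm_diff_le[of A B] op_norm_diff_le[of B A]
      by (simp add: dist_norm norm_minus_commute abs_le_iff)
  qed simp
qed

lemma continuous_on_transfer_matrix:
  assumes "continuous_on UNIV v"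
  shows "continuous_on S (\<lambda>x. transfer_matrix v v1 lam om n x E)"
proof (induction n)
  case (Suc n)
  have v: "continuous_on S (\<lambda>x. v (x + c))" for c
    by (intro continuous_on_compose2[OF assms] continuous_intros) auto
  have "continuous_on S (\<lambda>x. step_matrix v v1 lam om x E (Suc n) $ i $ j)" for i j
    using exhaust_2[of i] exhaust_2[of j]
    by (elim disjE; simp add: step_matrix_def vector_2 del: of_nat_Suc; intro continuous_intros v)
  moreover have "continuous_on S (\<lambda>x. transfer_matrix v v1 lam om n x E $ i $ j)" for i j
    by (intro continuous_on_component Suc)
  ultimately show ?case
    unfolding transfer_matrix.simps matrix_matrix_mult_def
    by (intro continuous_on_vec_lambda continuous_on_sum continuous_on_mult)
qed simp

section \<open>Lower bound for the Lyapunov exponent\<close>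

text \<open>This is \<open>log_norm_mean_bound\<close> for the continuant, whose modulus on the real
  axis is at most the operator norm. The sum \<open>X\<close> collects the factors common to the
  bounds at heights \<open>y\<close> and \<open>h\<close>.\<close>

lemma L_N_ge_mean:
  assumes v: "continuous_on UNIV v" and "V holomorphic_on strip \<rho>" "\<And>z. V (z + 1) = V z"
    and real: "\<And>x. V (of_real x) = complex_of_real (v x)"
    and y: "0 < y" "y \<le> h" "h < \<rho>"
    and lam: "lam > 0" and N: "N > 0"
    and s: "\<And>k. s k = max 1 \<bar>(E - v1 (int k)) / lam\<bar>"
    and c: "c > 0" "lam * c \<ge> 2"
    and lower: "\<And>z k. Im z = y \<Longrightarrow> c * s k \<le> norm (V z - of_real ((E - v1 (int k)) / lam))"
    and upper: "\<And>z. Im z = h \<Longrightarrow> norm (V z) \<le> S" and S: "S > 0" "lam \<ge> 1"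
  defines "X \<equiv> (\<Sum>k=1..N. ln (lam * s k))"
  shows "X + N * ln (c / 2) \<le> (1 - y / h) * (N * L_N v v1 lam om N E) + y / h * (X + N * ln (S + 2))"
proof -
  define w where "w k = (E - v1 (int k)) / lam" for k
  define a where "a z k = of_real lam * (of_real (w k) - V (z + of_real (real k * om)))" for z k
  have s1: "s k \<ge> 1" for k
    by (simp add: s)
  then have s0: "s k > 0" for k
    by (rule less_le_trans[OF zero_less_one])
  then have s_nz: "s k \<noteq> 0" for k
    by (metis less_irrefl)
  have X: "exp (X + N * ln r) = (\<Prod>k=1..N. lam * s k * r)" if "r > 0" for r
  proof -
    have "exp (X + N * ln r) = exp (\<Sum>k=1..N. ln (lam * s k * r))"
      using lam s0 s_nz that by (simp add: X_def ln_mult sum.distrib)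
    also have "\<dots> = (\<Prod>k=1..N. exp (ln (lam * s k * r)))"
      by (simp add: exp_sum)
    also have "\<dots> = (\<Prod>k=1..N. lam * s k * r)"
      using lam s0 s_nz that by (intro prod.cong) simp_all
    finally show ?thesis .
  qed
  let ?\<phi> = "\<lambda>x. ln (op_norm (transfer_matrix v v1 lam om N x E))"
  have "X + N * ln (c / 2) \<le> (1 - y / h) * integral {0..1} ?\<phi> + y / h * (X + N * ln (S + 2))"
  proof (rule log_norm_mean_bound[of "\<lambda>z. continuant (a z) N"])
    show "(\<lambda>z. continuant (a z) N) holomorphic_on strip \<rho>"
      unfolding a_def
      by (intro continuant_holomorphic_on holomorphic_intros holomorphic_on_strip_translate assms)
    show "continuant (a (z + 1)) N = continuant (a z) N" for z
    proof -
      have "a (z + 1) k = a z k" for k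
        using assms(3)[of "z + of_real (real k * om)"] by (simp add: a_def algebra_simps)
      then show ?thesis
        by presburger
    qed
    show "continuous_on {0..1} ?\<phi>"
      by (intro continuous_on_ln continuous_on_compose2[OF continuous_on_op_norm[of UNIV]]
            continuous_on_transfer_matrix v)
         (auto simp: op_norm_transfer_matrix_pos less_imp_neq[THEN not_sym])
    show "norm (continuant (a (of_real x)) N) \<le> exp (?\<phi> x)" for x
    proof -
      have "a (of_real x) = (\<lambda>k. of_real (E - lam * v (x + real k * om) - v1 (int k)))"
        using lam by (auto simp: a_def w_def real field_simps simp flip: of_real_add of_real_mult of_real_diff of_real_divide)
      then have "norm (continuant (a (of_real x)) N) = \<bar>transfer_matrix v v1 lam om N x E $ 1 $ 1\<bar>"
        by (simp only: continuant_of_real transfer_matrix_nth_continuant norm_of_real)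
      also have "\<dots> \<le> op_norm (transfer_matrix v v1 lam om N x E)"
        unfolding op_norm_def by (rule matrix_component_le_onorm)
      finally show ?thesis
        by (simp add: op_norm_transfer_matrix_pos)
    qed
    show "exp (X + N * ln (c / 2)) \<le> norm (continuant (a z) N)" if z: "Im z = y" for z
    proof -
      \<comment> \<open>Since \<open>lam * c\<close> is at least 2, half of
        \<open>lam * s k * c\<close> is at least 1. The other half therefore pays for the summand 1
        required by \<open>norm_continuant_ge\<close>.\<close>
      have l: "lam * s k * (c / 2) \<ge> 1" for k
        using mult_mono[OF c(2) s1[of k]] lam c by (simp add: mult_ac)
      have "lam * s k * (c / 2) + 1 \<le> norm (a z k)" for k
      proof -
        have "lam * (c * s k) \<le> lam * norm (V (z + of_real (real k * om)) - of_real (w k))"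
          using lower[of "z + of_real (real k * om)" k] z lam
          by (intro mult_left_mono) (simp_all add: w_def)
        also have "\<dots> = norm (a z k)"
          using lam by (simp add: a_def norm_mult norm_minus_commute)
        finally show ?thesis
          using l[of k] by (simp add: algebra_simps)
      qed
      then have "(\<Prod>k=1..N. lam * s k * (c / 2)) \<le> norm (continuant (a z) N)"
        using l by (rule norm_continuant_ge)
      then show ?thesis
        using X[of "c / 2"] c by simp
    qed
    show "norm (continuant (a z) N) \<le> exp (X + N * ln (S + 2))" if z: "Im z = h" for z
    proof -
      \<comment> \<open>The factor \<open>S + 1\<close> comes from bounding both
        \<open>\<bar>w k\<bar>\<close> and \<open>S\<close> by multiples of \<open>s k\<close>; one
        more unit covers the summand 1, because \<open>lam * s k\<close> is at least 1.\<close>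
      have "norm (a z k) + 1 \<le> lam * s k * (S + 2)" for k
      proof -
        have "norm (a z k) = lam * norm (of_real (w k) - V (z + of_real (real k * om)))"
          using lam by (simp add: a_def norm_mult)
        also have "\<dots> \<le> lam * (\<bar>w k\<bar> + S)"
          using lam upper[of "z + of_real (real k * om)"] z
            norm_triangle_ineq4[of "of_real (w k)" "V (z + of_real (real k * om))"]
          by (intro mult_left_mono) auto
        also have "\<dots> \<le> lam * (s k + s k * S)"
          using lam s[of k] s1[of k] S mult_right_mono[of 1 "s k" S]
          by (intro mult_left_mono add_mono) (auto simp: w_def)
        finally have "norm (a z k) \<le> lam * s k * (S + 1)"
          by (simp add: algebra_simps)
        moreover have "1 * 1 \<le> lam * s k"
          using S s1 by (intro mult_mono) auto
        ultimately show ?thesis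
          by (simp add: algebra_simps)
      qed
      then have "norm (continuant (a z) N) \<le> (\<Prod>k=1..N. lam * s k * (S + 2))"
        by (rule norm_continuant_le)
      then show ?thesis
        using X[of "S + 2"] S by simp
    qed
  qed (use y in auto)
  then show ?thesis
    using N by (simp add: L_N_def)
qed

text \<open>Subtracting \<open>t * X\<close> from both sides leaves \<open>1 - t\<close> times
  \<open>N * ?L - X\<close>, bounded below by \<open>- N * D\<close>. As \<open>1 - t\<close> is at
  least 1/2, division costs a factor 2, and \<open>X\<close> is at least \<open>N * ln lam\<close>
  because every \<open>s k\<close> is at least 1.\<close>

lemma L_N_lower_bound:
  assumes v: "continuous_on UNIV v" and V: "V holomorphic_on strip \<rho>" "\<And>z. V (z + 1) = V z"
    and real: "\<And>x. V (of_real x) = complex_of_real (v x)"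
    and y: "0 < y" "2 * y \<le> h" "h < \<rho>"
    and lam: "lam \<ge> 1" and N: "N > 0"
    and c: "c > 0" "lam * c \<ge> 2"
    and lower: "\<And>z k. Im z = y \<Longrightarrow>
      c * max 1 \<bar>(E - v1 (int k)) / lam\<bar> \<le> norm (V z - of_real ((E - v1 (int k)) / lam))"
    and upper: "\<And>z. Im z = h \<Longrightarrow> norm (V z) \<le> S" and S: "S > 0"
  shows "ln lam - 2 * (\<bar>ln (c / 2)\<bar> + \<bar>ln (S + 2)\<bar>) \<le> L_N v v1 lam om N E"
proof -
  define s where "s k = max 1 \<bar>(E - v1 (int k)) / lam\<bar>" for k
  define X where "X = (\<Sum>k=1..N. ln (lam * s k))"
  define t where "t = y / h"
  define D where "D = \<bar>ln (c / 2)\<bar> + \<bar>ln (S + 2)\<bar>"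
  let ?L = "L_N v v1 lam om N E"
  have t: "0 \<le> t" "t \<le> 1/2"
    using y by (auto simp: t_def field_simps)
  have "X + N * ln (c / 2) \<le> (1 - t) * (N * ?L) + t * (X + N * ln (S + 2))"
    unfolding X_def t_def s_def
    by (rule L_N_ge_mean[OF v V real]) (use assms in auto)
  then have "N * (ln (c / 2) - t * ln (S + 2)) \<le> (1 - t) * (N * ?L - X)"
    by (simp add: algebra_simps)
  moreover have "- D \<le> ln (c / 2) - t * ln (S + 2)"
  proof -
    have "t * ln (S + 2) \<le> t * \<bar>ln (S + 2)\<bar>"
      using t by (intro mult_left_mono) auto
    moreover have "t * \<bar>ln (S + 2)\<bar> \<le> 1 * \<bar>ln (S + 2)\<bar>"
      using t by (intro mult_right_mono) auto
    ultimately show ?thesis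
      unfolding D_def by linarith
  qed
  then have "real N * (- D) \<le> N * (ln (c / 2) - t * ln (S + 2))"
    by (rule mult_left_mono) simp
  ultimately have *: "- (N * D) \<le> (1 - t) * (N * ?L - X)"
    by simp
  have "X - 2 * (N * D) \<le> N * ?L"
  \<comment> \<open>Replacing \<open>1 - t\<close> by 1/2 is legitimate only for a nonpositive
    difference; otherwise the claim follows from \<open>D\<close> being nonnegative.\<close>
  proof (cases "N * ?L - X \<le> 0")
    case True
    then have "(1 - t) * (N * ?L - X) \<le> 1/2 * (N * ?L - X)"
      using t by (intro mult_right_mono_neg) auto
    with * have "- (N * D) \<le> 1/2 * (N * ?L - X)"
      by (rule order_trans)
    then show ?thesis
      by simp
  next
    case False
    moreover have "N * D \<ge> 0"
      by (simp add: D_def)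
    ultimately show ?thesis by simp
  qed
  moreover have "N * ln lam \<le> X"
  proof -
    have "lam * 1 \<le> lam * s k" for k
      using lam by (intro mult_left_mono) (auto simp: s_def)
    then have "(\<Sum>k=1..N. ln lam) \<le> X"
      unfolding X_def using lam by (intro sum_mono) (simp add: ln_mono)
    then show ?thesis by simp
  qed
  ultimately have "N * (ln lam - 2 * D) \<le> N * ?L"
    by (simp add: algebra_simps)
  then show ?thesis
    using N by (simp add: D_def)
qed

theorem theorem1:
  fixes v :: "real \<Rightarrow> real"
  assumes "\<And>x. v (x + 1) = v x"
    and "real_analytic v"
    and "\<exists>x y. v x \<noteq> v y"
  shows "\<forall>q::nat. \<exists>lam0 > 0. \<exists>C::real.
           \<forall>lam > lam0. \<forall>om::real. \<forall>v1 :: int \<Rightarrow> real. \<forall>E::real.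
             finite (range v1) \<and> card (range v1) \<le> q \<longrightarrow>
             ereal (ln lam - C) \<le> lower_lyap v v1 lam om E"
proof
  fix q :: nat
  obtain \<rho> V where \<rho>: "\<rho> > 0" and V: "V holomorphic_on strip \<rho>" "\<And>z. V (z + 1) = V z"
    and real: "\<And>x. V (of_real x) = complex_of_real (v x)"
    using periodic_real_analytic_extension[OF assms(1,2)] by metis
  have reals: "complex_of_real x \<in> strip \<rho>" for x
    using \<rho> by (simp add: strip_def)
  have nc: "\<not> V constant_on strip \<rho>"
    using assms(3) reals real unfolding constant_on_def by (metis of_real_eq_iff)
  have "continuous_on UNIV (\<lambda>x. Re (V (of_real x)))"
    by (intro continuous_intros continuous_on_compose2[OF holomorphic_on_imp_continuous_on[OF V(1)]])
       (use reals in auto)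
  then have cont: "continuous_on UNIV v"
    by (simp add: real)
  \<comment> \<open>With \<open>y\<close> between \<open>\<rho>/6\<close> and
    \<open>\<rho>/3\<close> this height satisfies \<open>2 * y \<le> h\<close> and
    \<open>h < \<rho>\<close>.\<close>
  define h where "h = 2 * \<rho> / 3"
  obtain S where S: "S > 0" "\<And>z. Im z \<in> {h..h} \<Longrightarrow> norm (V z) \<le> S"
    using periodic_bounded_on_substrip[OF V, of h h] \<rho> by (auto simp: h_def)
  obtain c where c: "c > 0"
    and avoid: "\<And>W. finite W \<Longrightarrow> card W \<le> q \<Longrightarrow>
      \<exists>y\<in>{\<rho>/6..\<rho>/3}. \<forall>w\<in>W. \<forall>z. Im z = y \<longrightarrow> c * max 1 (norm w) \<le> norm (V z - w)"
    using line_avoiding_values[OF V nc, of "\<rho>/6" "\<rho>/3" q] \<rho> by auto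
  define C where "C = 2 * (\<bar>ln (c / 2)\<bar> + \<bar>ln (S + 2)\<bar>)"
  \<comment> \<open>The threshold \<open>max 1 (2 / c)\<close> ensures both
    \<open>lam \<ge> 1\<close> and \<open>lam * c \<ge> 2\<close>.\<close>
  have "ereal (ln lam - C) \<le> lower_lyap v v1 lam om E"
    if lam: "lam > max 1 (2 / c)" and v1: "finite (range v1)" "card (range v1) \<le> q"
    for lam om E and v1 :: "int \<Rightarrow> real"
  proof -
    \<comment> \<open>These values, and hence the height \<open>y\<close>, depend on
      \<open>E\<close>, \<open>lam\<close> and the background. The constant \<open>c\<close> was
      fixed before them and depends only on \<open>V\<close>, the strip and
      \<open>q\<close>.\<close>
    let ?W = "(\<lambda>t. complex_of_real ((E - t) / lam)) ` range v1"
    have "card ?W \<le> q"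
      using card_image_le[OF v1(1)] v1(2) order_trans by blast
    then obtain y where y: "y \<in> {\<rho>/6..\<rho>/3}"
      and W: "\<And>w z. w \<in> ?W \<Longrightarrow> Im z = y \<Longrightarrow> c * max 1 (norm w) \<le> norm (V z - w)"
      using avoid[of ?W] v1(1) by blast
    have "c * max 1 \<bar>(E - v1 (int k)) / lam\<bar> \<le> norm (V z - of_real ((E - v1 (int k)) / lam))"
      if "Im z = y" for z k
    proof -
      have "complex_of_real ((E - v1 (int k)) / lam) \<in> ?W"
        by blast
      from W[OF this that] show ?thesis
        by (simp only: norm_of_real)
    qed
    \<comment> \<open>The bound holds at every positive scale \<open>N\<close>, so it passes to the
      lower limit.\<close>
    then have "ln lam - C \<le> L_N v v1 lam om N E" if "N > 0" for N
      unfolding C_def using y \<rho> c lam S that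
      by (intro L_N_lower_bound[OF cont V real, of y h]) (auto simp: h_def field_simps)
    then have "eventually (\<lambda>N. ereal (ln lam - C) \<le> ereal (L_N v v1 lam om N E)) sequentially"
      by (intro eventually_mono[OF eventually_gt_at_top[of 0]]) simp
    then show ?thesis
      unfolding lower_lyap_def by (rule Liminf_bounded)
  qed
  moreover have "max 1 (2 / c) > 0"
    by simp
  ultimately show "\<exists>lam0 > 0. \<exists>C::real.
           \<forall>lam > lam0. \<forall>om::real. \<forall>v1 :: int \<Rightarrow> real. \<forall>E::real.
             finite (range v1) \<and> card (range v1) \<le> q \<longrightarrow>
             ereal (ln lam - C) \<le> lower_lyap v v1 lam om E"
    by blast
qed

end
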